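(* Let $h=(h_1,\ldots,h_n)$ be a Hessenberg function. Then $I_h\subseteq I_h^{AD}$; in particular $I_h$ is generated by the $n$ polynomials $e_{h_i-(i-1)}(1,\ldots,h_i)$, $i=1,\ldots,n$.
   Context: A Hessenberg function is an $n$-tuple $h=(h_1,\ldots,h_n)$ of integers with $i\le h_i\le n$ for all $i$ and $h_i\le h_{i+1}$ for $1\le i\le n-1$. For $S\subseteq\{1,\ldots,n\}$, $e_d(S)$ is the sum of all squarefree monomials of degree $d$ in $x_i$, $i\in S$ (with $e_0(S)=1$, $e_d(S)=0$ for $d<0$ or $d>|S|$), and $e_d(1,\ldots,m)$ means $S=\{1,\ldots,m\}$. $I_h$ is the ideal of $\mathbb{Z}[x_1,\ldots,x_n]$ generated by $\{e_{h_i-r}(1,\ldots,h_i): 1\le i\le n,\ 0\le r\le i-1\}$, and $I_h^{AD}\subseteq I_h$ is the ideal generated by $e_{h_i-(i-1)}(1,\ldots,h_i)$ for $i=1,\ldots,n$. *)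

theory Defs
  imports "HOL-Algebra.Ideal" "HOL-Library.Poly_Mapping"
begin

definition mpoly_ring :: "nat \<Rightarrow> ((nat \<Rightarrow>\<^sub>0 nat) \<Rightarrow>\<^sub>0 int) ring" where
  \<comment> \<open>\<open>\<int>[x\<^sub>1,\<dots>,x\<^sub>n]\<close>: the type has a variable for every natural number; the carrier keeps
      the polynomials in which only variables with index in \<open>{1..n}\<close> occur.\<close>
  "mpoly_ring n =
     \<lparr>carrier = {p. \<forall>m\<in>Poly_Mapping.keys p. Poly_Mapping.keys m \<subseteq> {1..n}},
      monoid.mult = (*), one = 1, zero = 0, add = (+)\<rparr>"

definition mvar :: "nat \<Rightarrow> (nat \<Rightarrow>\<^sub>0 nat) \<Rightarrow>\<^sub>0 int" where
  "mvar i = Poly_Mapping.single (Poly_Mapping.single i 1) 1"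

definition esym :: "int \<Rightarrow> nat set \<Rightarrow> (nat \<Rightarrow>\<^sub>0 nat) \<Rightarrow>\<^sub>0 int" where
  "esym d S = (\<Sum>T | T \<subseteq> S \<and> int (card T) = d. \<Prod>i\<in>T. mvar i)"

definition hessenberg :: "nat \<Rightarrow> (nat \<Rightarrow> nat) \<Rightarrow> bool" where
  \<comment> \<open>Only the values of \<open>h\<close> on \<open>{1..n}\<close> are relevant. Natural-number values lose nothing,
      because \<open>i \<le> h\<^sub>i\<close> forces every entry to be positive.\<close>
  "hessenberg n h \<longleftrightarrow>
     (\<forall>i\<in>{1..n}. i \<le> h i \<and> h i \<le> n) \<and> (\<forall>i\<in>{1..<n}. h i \<le> h (i + 1))"

definition hess_ideal :: "nat \<Rightarrow> (nat \<Rightarrow> nat) \<Rightarrow> ((nat \<Rightarrow>\<^sub>0 nat) \<Rightarrow>\<^sub>0 int) set" where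
  "hess_ideal n h = genideal (mpoly_ring n)
     {esym (int (h i) - int r) {1..h i} | i r. i \<in> {1..n} \<and> r \<in> {0..i - 1}}"

definition hess_ideal_AD :: "nat \<Rightarrow> (nat \<Rightarrow> nat) \<Rightarrow> ((nat \<Rightarrow>\<^sub>0 nat) \<Rightarrow>\<^sub>0 int) set" where
  "hess_ideal_AD n h = genideal (mpoly_ring n)
     {esym (int (h i) - (int i - 1)) {1..h i} | i. i \<in> {1..n}}"

lemma mpoly_ring_simps [simp]:
  "mult (mpoly_ring n) = (*)" "one (mpoly_ring n) = 1"
  "zero (mpoly_ring n) = 0" "add (mpoly_ring n) = (+)"
  by (simp_all add: mpoly_ring_def)

lemma mem_carrier_mpoly_ring:
  "p \<in> carrier (mpoly_ring n) \<longleftrightarrow> (\<forall>m\<in>Poly_Mapping.keys p. Poly_Mapping.keys m \<subseteq> {1..n})"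
  by (simp add: mpoly_ring_def)

lemma mult_carrier_mpoly_ring:
  assumes "p \<in> carrier (mpoly_ring n)" "q \<in> carrier (mpoly_ring n)"
  shows "p * q \<in> carrier (mpoly_ring n)"
  unfolding mem_carrier_mpoly_ring
proof
  fix m assume "m \<in> Poly_Mapping.keys (p * q)"
  then obtain a b where ab: "m = a + b" "a \<in> Poly_Mapping.keys p" "b \<in> Poly_Mapping.keys q"
    using keys_mult[of p q] by blast
  have "Poly_Mapping.keys m \<subseteq> Poly_Mapping.keys a \<union> Poly_Mapping.keys b"
    unfolding ab(1) by (rule keys_add)
  with ab(2,3) assms show "Poly_Mapping.keys m \<subseteq> {1..n}"
    by (auto simp: mem_carrier_mpoly_ring dest!: bspec)
qed

lemma add_carrier_mpoly_ring:
  assumes "p \<in> carrier (mpoly_ring n)" "q \<in> carrier (mpoly_ring n)"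
  shows "p + q \<in> carrier (mpoly_ring n)"
  using assms keys_add[of p q] by (auto simp: mem_carrier_mpoly_ring)

lemma cring_mpoly_ring: "cring (mpoly_ring n)"
proof (rule cringI)
  show "abelian_group (mpoly_ring n)"
  proof (rule abelian_groupI)
    fix p assume "p \<in> carrier (mpoly_ring n)"
    then have "- p \<in> carrier (mpoly_ring n)"
      by (simp add: mem_carrier_mpoly_ring)
    then show "\<exists>q\<in>carrier (mpoly_ring n). q \<oplus>\<^bsub>mpoly_ring n\<^esub> p = \<zero>\<^bsub>mpoly_ring n\<^esub>"
      by (intro bexI[of _ "- p"]) auto
  qed (auto simp: add_carrier_mpoly_ring add.assoc add.commute mem_carrier_mpoly_ring[of 0])
  show "comm_monoid (mpoly_ring n)"
    by (rule comm_monoidI)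
      (auto simp: mult_carrier_mpoly_ring mult.assoc mult.commute mem_carrier_mpoly_ring[of 1])
qed (simp add: distrib_right)

lemma mvar_carrier_mpoly_ring: "i \<in> {1..n} \<Longrightarrow> mvar i \<in> carrier (mpoly_ring n)"
  by (simp add: mvar_def mem_carrier_mpoly_ring)

lemma esym_carrier_mpoly_ring:
  assumes "S \<subseteq> {1..n}"
  shows "esym d S \<in> carrier (mpoly_ring n)"
proof -
  have zero: "0 \<in> carrier (mpoly_ring n)" and one: "1 \<in> carrier (mpoly_ring n)"
    by (simp_all add: mem_carrier_mpoly_ring)
  have prod: "prod mvar T \<in> carrier (mpoly_ring n)" if "T \<subseteq> {1..n}" for T
    using finite_subset[OF that] that
    by (induction T rule: infinite_finite_induct)
      (auto simp: one intro!: mult_carrier_mpoly_ring mvar_carrier_mpoly_ring)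
  have "(\<Sum>T\<in>A. prod mvar T) \<in> carrier (mpoly_ring n)" if "\<forall>T\<in>A. T \<subseteq> {1..n}" for A
    using that
    by (induction A rule: infinite_finite_induct)
      (simp_all add: zero add_carrier_mpoly_ring prod)
  moreover have "\<forall>T\<in>{T. T \<subseteq> S \<and> int (card T) = d}. T \<subseteq> {1..n}"
    using assms by blast
  ultimately show ?thesis
    unfolding esym_def by blast
qed

lemma esym_0: "finite S \<Longrightarrow> esym 0 S = 1"
proof -
  assume "finite S"
  then have "{T. T \<subseteq> S \<and> int (card T) = 0} = {{}}"
    by (auto dest: finite_subset)
  then show ?thesis by (simp only: esym_def) simp
qed

lemma esym_neg: "d < 0 \<Longrightarrow> esym d S = 0"
  by (auto simp: esym_def intro!: sum.neutral)

lemma esym_gt_card: "finite S \<Longrightarrow> d > int (card S) \<Longrightarrow> esym d S = 0"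
  by (auto simp: esym_def dest: card_mono intro!: sum.neutral)

end

theory Submission imports Defs begin

text \<open>
  The recursion \<open>e\<^sub>d(1,\<dots>,m+1) = e\<^sub>d(1,\<dots>,m) + x\<^sub>m\<^sub>+\<^sub>1 e\<^sub>d\<^sub>-\<^sub>1(1,\<dots>,m)\<close> shows that if an ideal contains
  \<open>e\<^sub>m\<^sub>-\<^sub>r(1,\<dots>,m)\<close> for all \<open>r < k\<close>, then it contains \<open>e\<^sub>m\<^sub>+\<^sub>1\<^sub>-\<^sub>r(1,\<dots>,m+1)\<close> for all \<open>r < k\<close>. Hence the
  generators of \<open>I\<^sub>h\<close> attached to \<open>i\<close> yield those attached to \<open>i + 1\<close> with \<open>r < i\<close>, and the remaining
  one, \<open>r = i\<close>, is a generator of \<open>I\<^sub>h\<^sup>A\<^sup>D\<close>.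
\<close>

text \<open>Subsets of \<open>insert x S\<close> are sorted by whether they contain
  \<open>x\<close>; removing \<open>x\<close> lowers the size by one. With integer degrees,
  \<open>d = 0\<close> needs no special case: no set has size -1.\<close>

lemma esym_insert:
  assumes "finite S" "x \<notin> S"
  shows "esym d (insert x S) = esym d S + mvar x * esym (d - 1) S"
proof -
  let ?A = "\<lambda>d. {T. T \<subseteq> S \<and> int (card T) = d}"
  have fin: "finite T" "x \<notin> T" if "T \<subseteq> S" for T
    using that assms finite_subset by auto
  have fA: "finite (?A d)" for d
    using assms(1) by simp
  have split: "{T. T \<subseteq> insert x S \<and> int (card T) = d} = ?A d \<union> insert x ` ?A (d - 1)"
  proof (intro equalityI subsetI)
    fix T assume T: "T \<in> {T. T \<subseteq> insert x S \<and> int (card T) = d}"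
    show "T \<in> ?A d \<union> insert x ` ?A (d - 1)"
    proof (cases "x \<in> T")
      case True
      have sub: "T - {x} \<subseteq> S" using T by auto
      have eq: "T = insert x (T - {x})" using True by auto
      then have "card T = Suc (card (T - {x}))"
        using fin[OF sub] card_insert_disjoint by metis
      then have "T - {x} \<in> ?A (d - 1)" using T sub by auto
      then show ?thesis using eq by blast
    qed (use T in auto)
  qed (auto simp: fin)
  have inj: "inj_on (insert x) (?A (d - 1))"
    using fin(2) by (intro inj_onI) (metis (no_types, lifting) insert_ident mem_Collect_eq)
  have "esym d (insert x S) = esym d S + (\<Sum>T\<in>insert x ` ?A (d - 1). prod mvar T)"
    unfolding esym_def split by (rule sum.union_disjoint) (use fA fin(2) in auto)
  also have "(\<Sum>T\<in>insert x ` ?A (d - 1). prod mvar T) = (\<Sum>T\<in>?A (d - 1). mvar x * prod mvar T)"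
    by (subst sum.reindex[OF inj]) (auto simp: fin intro!: sum.cong)
  finally show ?thesis
    by (simp add: esym_def sum_distrib_left)
qed

lemma esym_mem_ideal_mono:
  assumes I: "ideal I (mpoly_ring n)"
    and base: "\<And>r. r < k \<Longrightarrow> esym (int m - int r) {1..m} \<in> I"
    and "m \<le> m'" "m' \<le> n" "r < k"
  shows "esym (int m' - int r) {1..m'} \<in> I"
  using \<open>m \<le> m'\<close> \<open>m' \<le> n\<close> \<open>r < k\<close>
\<comment> \<open>\<open>r\<close> stays arbitrary because the step for a positive \<open>r\<close>
  uses both \<open>r\<close> and \<open>r - 1\<close> at the previous level.\<close>
proof (induction m' arbitrary: r rule: dec_induct)
  case base
  then show ?case using assms(2) by simp
next
  case (step j)
  interpret ideal I "mpoly_ring n" by (rule I)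
  have IH: "esym (int j - int s) {1..j} \<in> I" if "s < k" for s
    using step that by simp
  \<comment> \<open>For \<open>r = 0\<close> the degree \<open>j + 1\<close> exceeds the number of
    variables, so the polynomial vanishes; for \<open>r = Suc s\<close> it is the induction
    hypothesis at \<open>s\<close>.\<close>
  have "esym (int (Suc j) - int r) {1..j} \<in> I"
  proof (cases r)
    case 0
    then show ?thesis using additive_subgroup.zero_closed[OF is_additive_subgroup] by (simp add: esym_gt_card)
  next
    case (Suc s)
    then show ?thesis using IH[of s] step.prems by simp
  qed
  moreover have "mvar (Suc j) * esym (int j - int r) {1..j} \<in> I"
    using I_l_closed[OF IH[OF step.prems(2)] mvar_carrier_mpoly_ring[of "Suc j"]] step by simp
  ultimately have "esym (int (Suc j) - int r) {1..j}
      + mvar (Suc j) * esym (int j - int r) {1..j} \<in> I"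
    using additive_subgroup.a_closed[OF is_additive_subgroup] by simp
  moreover have "{1..Suc j} = insert (Suc j) {1..j}" by auto
  ultimately show ?case by (simp add: esym_insert algebra_simps)
qed

lemma esym_mem_ideal_of_hessenberg:
  assumes I: "ideal I (mpoly_ring n)" and h: "hessenberg n h"
    and gen: "\<And>i. i \<in> {1..n} \<Longrightarrow> esym (int (h i) - (int i - 1)) {1..h i} \<in> I"
    and "1 \<le> i" "i \<le> n" "r < i"
  shows "esym (int (h i) - int r) {1..h i} \<in> I"
  using \<open>1 \<le> i\<close> \<open>i \<le> n\<close> \<open>r < i\<close>
proof (induction i arbitrary: r rule: dec_induct)
  case base
  then show ?case using gen[of 1] by simp
next
  case (step i)
  show ?case
  proof (cases "r = i")
    case True
    then show ?thesis using gen[of "Suc i"] step.prems by simp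
  next
    case False
    \<comment> \<open>Here \<open>r < i\<close>, so the induction hypothesis at \<open>i\<close> is
      carried from \<open>h i\<close> up to \<open>h (Suc i)\<close> variables, with
      \<open>k = i\<close>.\<close>
    have "h i \<le> h (Suc i)" "h (Suc i) \<le> n"
      using h step by (auto simp: hessenberg_def)
    then show ?thesis
      using esym_mem_ideal_mono[OF I, of i "h i" "h (Suc i)" r] step False by simp
  qed
qed

theorem theorem4p16:
  fixes n :: nat and h :: "nat \<Rightarrow> nat"
  assumes "hessenberg n h"
  shows "hess_ideal n h \<subseteq> hess_ideal_AD n h \<and>
         hess_ideal n h = genideal (mpoly_ring n)
           {esym (int (h i) - (int i - 1)) {1..h i} | i. i \<in> {1..n}}"
proof -
  interpret cring "mpoly_ring n" by (rule cring_mpoly_ring)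
  let ?G = "{esym (int (h i) - int r) {1..h i} | i r. i \<in> {1..n} \<and> r \<in> {0..i - 1}}"
  let ?D = "{esym (int (h i) - (int i - 1)) {1..h i} | i. i \<in> {1..n}}"
  have hn: "{1..h i} \<subseteq> {1..n}" if "i \<in> {1..n}" for i
    using assms that by (auto simp: hessenberg_def)
  have G: "?G \<subseteq> carrier (mpoly_ring n)" and D: "?D \<subseteq> carrier (mpoly_ring n)"
    using esym_carrier_mpoly_ring[OF hn] by blast+
  have AD: "ideal (hess_ideal_AD n h) (mpoly_ring n)"
    unfolding hess_ideal_AD_def by (rule genideal_ideal[OF D])
  have "?D \<subseteq> hess_ideal_AD n h"
    unfolding hess_ideal_AD_def by (rule genideal_self[OF D])
  then have "esym (int (h i) - (int i - 1)) {1..h i} \<in> hess_ideal_AD n h" if "i \<in> {1..n}" for i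
    using that by blast
  then have "?G \<subseteq> hess_ideal_AD n h"
    using esym_mem_ideal_of_hessenberg[OF AD assms] by fastforce
  then have sub: "hess_ideal n h \<subseteq> hess_ideal_AD n h"
    unfolding hess_ideal_def by (rule genideal_minimal[OF AD])
  \<comment> \<open>Take \<open>r = i - 1\<close>; natural and integer subtraction agree since
    \<open>1 \<le> i\<close>.\<close>
  have "?D \<subseteq> ?G"
  proof
    fix p assume "p \<in> ?D"
    then obtain i where i: "i \<in> {1..n}" "p = esym (int (h i) - (int i - 1)) {1..h i}" by blast
    then have "p = esym (int (h i) - int (i - 1)) {1..h i}" by (simp add: of_nat_diff)
    then show "p \<in> ?G" using i(1) by fastforce
  qed
  then have "?D \<subseteq> hess_ideal n h"
    unfolding hess_ideal_def using genideal_self[OF G] by (rule order_trans)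
  then have "hess_ideal_AD n h \<subseteq> hess_ideal n h"
    unfolding hess_ideal_AD_def hess_ideal_def by (rule genideal_minimal[OF genideal_ideal[OF G]])
  with sub show ?thesis
    by (auto simp: hess_ideal_AD_def)
qed

end
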